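(* Let $p$ be a prime and $x\in\mathbb{Z}_p$. For every integer $n\ge0$, \[ D_n(x)=\int_{\mathbb{Z}_p}(x+y)_n\,d\mu_0(y), \] and, as polynomials in $x$, \[ D_n(x)=B_n^{(n+2)}(x+1). \]
   Context: $(z)_n=z(z-1)\cdots(z-n+1)$ with $(z)_0=1$. For a uniformly differentiable function $f:\mathbb{Z}_p\to\mathbb{C}_p$, the $p$-adic invariant (Volkenborn) integral is $\int_{\mathbb{Z}_p}f(y)\,d\mu_0(y)=\lim_{N\to\infty}\frac{1}{p^N}\sum_{y=0}^{p^N-1}f(y)$. The Daehee polynomials $D_n(x)$ are defined by $\frac{\log(1+t)}{t}(1+t)^x=\sum_{n\ge0}D_n(x)\frac{t^n}{n!}$. For an integer $\alpha$, the Bernoulli polynomials of order $\alpha$ are defined by $\left(\frac{t}{e^t-1}\right)^{\alpha}e^{xt}=\sum_{n\ge0}B_n^{(\alpha)}(x)\frac{t^n}{n!}$. *)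

theory Defs
  imports "HOL-Analysis.Analysis" "HOL-Computational_Algebra.Computational_Algebra"
begin

section \<open>Falling factorials, Daehee polynomials, Bernoulli polynomials of integer order\<close>

definition falling :: "'a::comm_ring_1 \<Rightarrow> nat \<Rightarrow> 'a" where
  "falling z n = (\<Prod>k<n. z - of_nat k)"

text \<open>
  The generating functions live in the ring of formal power series in \<open>t\<close> over the polynomial
  ring in the indeterminate \<open>x = [:0, 1:]\<close>.
\<close>

definition fps_to_poly_fps :: "'a::zero fps \<Rightarrow> 'a poly fps" where
  "fps_to_poly_fps F = Abs_fps (\<lambda>n. [:fps_nth F n:])"

text \<open>\<open>(1 + t)\<^sup>x = \<Sum>n. (x)\<^sub>n t\<^sup>n / n!\<close> for an indeterminate exponent \<open>x\<close>\<close>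

definition one_plus_t_powr_x :: "'a::field_char_0 poly fps" where
  "one_plus_t_powr_x = Abs_fps (\<lambda>n. smult (1 / fact n) (falling [:0, 1:] n))"

text \<open>\<open>exp (x t)\<close> for an indeterminate \<open>x\<close>\<close>

definition exp_xt :: "'a::field_char_0 poly fps" where
  "exp_xt = Abs_fps (\<lambda>n. smult (1 / fact n) ([:0, 1:] ^ n))"

text \<open>\<open>fps_ln 1\<close> is the series of \<open>log (1 + t)\<close>.\<close>

definition daehee_poly :: "nat \<Rightarrow> 'a::field_char_0 poly" where
  "daehee_poly n =
     smult (fact n) (fps_nth (fps_to_poly_fps (fps_ln 1 / fps_X) * one_plus_t_powr_x) n)"

text \<open>\<open>bernoulli_poly \<alpha> n\<close> is \<open>B\<^sub>n\<close> of order \<open>\<alpha>\<close>.\<close>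

definition bernoulli_poly :: "int \<Rightarrow> nat \<Rightarrow> 'a::field_char_0 poly" where
  "bernoulli_poly \<alpha> n =
     smult (fact n)
       (fps_nth (fps_to_poly_fps ((fps_X / (fps_exp 1 - 1)) powi \<alpha>) * exp_xt) n)"

text \<open>Evaluating at a scalar \<open>x\<close> gives the usual generating functions over the field.\<close>

lemma poly_falling: "poly (falling [:0, 1:] n) x = falling x n"
  by (simp add: falling_def poly_prod of_nat_poly)

lemma falling_eq_gbinomial: "falling x n = fact n * ((x::'a::field_char_0) gchoose n)"
  by (simp add: falling_def gbinomial_prod_rev atLeast0LessThan)

lemma poly_nth_fps_to_poly_fps_mult:
  fixes F :: "'a::comm_semiring_1 fps"
  shows "poly (fps_nth (fps_to_poly_fps F * G) n) x =
           fps_nth (F * Abs_fps (\<lambda>k. poly (fps_nth G k) x)) n"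
  by (simp add: fps_mult_nth fps_to_poly_fps_def poly_sum)

lemma poly_daehee_poly:
  "poly (daehee_poly n) x = fact n * fps_nth (fps_ln 1 / fps_X * fps_binomial x) n"
proof -
  have "Abs_fps (\<lambda>k. poly (fps_nth one_plus_t_powr_x k) x) = fps_binomial x"
    by (rule fps_ext)
       (simp add: one_plus_t_powr_x_def poly_falling falling_eq_gbinomial)
  then show ?thesis
    by (simp add: daehee_poly_def poly_nth_fps_to_poly_fps_mult)
qed

lemma poly_bernoulli_poly:
  "poly (bernoulli_poly \<alpha> n) x =
     fact n * fps_nth ((fps_X / (fps_exp 1 - 1)) powi \<alpha> * fps_exp x) n"
proof -
  have "Abs_fps (\<lambda>k. poly (fps_nth exp_xt k) x) = fps_exp x"
    by (rule fps_ext) (simp add: exp_xt_def poly_power fps_exp_def)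
  then show ?thesis
    by (simp add: bernoulli_poly_def poly_nth_fps_to_poly_fps_mult)
qed


section \<open>The field of complex p-adic numbers\<close>

text \<open>
  The field \<open>\<complex>\<^sub>p\<close> is treated axiomatically, as a field \<open>'c\<close> with an absolute value \<open>v\<close>; \<open>\<rat>\<^sub>p\<close> is
  the closure of the rational numbers in it, and \<open>\<int>\<^sub>p\<close> the set of those elements of \<open>\<rat>\<^sub>p\<close> that have
  absolute value at most 1.
\<close>

abbreviation vdist :: "('c::field \<Rightarrow> real) \<Rightarrow> 'c \<Rightarrow> 'c \<Rightarrow> real" where
  "vdist v \<equiv> (\<lambda>a b. v (a - b))"

abbreviation vtopology :: "('c::field \<Rightarrow> real) \<Rightarrow> 'c topology" where
  "vtopology v \<equiv> Metric_space.mtopology UNIV (vdist v)"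

definition Qp :: "('c::field_char_0 \<Rightarrow> real) \<Rightarrow> 'c set" where
  "Qp v = vtopology v closure_of \<rat>"

definition Zp :: "('c::field_char_0 \<Rightarrow> real) \<Rightarrow> 'c set" where
  "Zp v = {x \<in> Qp v. v x \<le> 1}"

locale ultrametric_absolute_value =
  fixes v :: "'c::field_char_0 \<Rightarrow> real"
  assumes nonneg: "v a \<ge> 0"
    and eq_0_iff: "v a = 0 \<longleftrightarrow> a = 0"
    and mult: "v (a * b) = v a * v b"
    and ultrametric: "v (a + b) \<le> max (v a) (v b)"
begin

lemma v_one: "v 1 = 1"
  using mult[of 1 1] eq_0_iff[of 1] by simp

lemma v_uminus: "v (- a) = v a"
proof -
  have "v (- 1) * v (- 1) = 1"
    using mult[of "- 1" "- 1"] v_one by simp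
  then have "v (- 1) = 1"
    using nonneg[of "- 1"] by (auto simp: square_eq_1_iff)
  then show ?thesis
    using mult[of "- 1" a] by simp
qed

sublocale Metric_space UNIV "vdist v"
proof
  show "v (x - y) = v (y - x)" for x y
    using v_uminus[of "x - y"] by simp
  show "v (x - z) \<le> v (x - y) + v (y - z)" for x y z
    using ultrametric[of "x - y" "y - z"] nonneg[of "x - y"] nonneg[of "y - z"] by simp
qed (simp_all add: nonneg eq_0_iff)

end

text \<open>
  The normalisation of \<open>v p\<close> makes \<open>v\<close> extend the \<open>p\<close>-adic absolute value of the rational numbers.
  By completeness, \<open>Qp v\<close> is then the field of \<open>p\<close>-adic numbers, the elements of \<open>'c\<close> algebraic over
  \<open>Qp v\<close> form an algebraic closure of it, and the density condition makes \<open>'c\<close> the completion of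
  that algebraic closure; so the locale determines \<open>('c, v)\<close> up to isometric isomorphism.
\<close>

locale complex_padic_field = ultrametric_absolute_value v
  for p :: nat and v :: "'c::field_char_0 \<Rightarrow> real" +
  assumes v_p: "v (of_nat p) = 1 / real p"
    and complete: "mcomplete"
    and algebraically_closed: "degree q > 0 \<Longrightarrow> \<exists>z::'c. poly q z = 0"
    and algebraic_dense:
      "mtopology closure_of
         {z. \<exists>q. q \<noteq> 0 \<and> (\<forall>i. coeff q i \<in> Qp v) \<and> poly q z = 0} = UNIV"


section \<open>The Volkenborn integral\<close>

text \<open>The difference quotient of \<open>f\<close> has a limit at every diagonal point \<open>(a, a)\<close>.\<close>

definition uniformly_differentiable ::
    "('c::field_char_0 \<Rightarrow> real) \<Rightarrow> ('c \<Rightarrow> 'c) \<Rightarrow> bool" where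
  "uniformly_differentiable v f \<longleftrightarrow>
     (\<forall>a\<in>Zp v. \<exists>l. \<forall>\<epsilon>>0. \<exists>\<delta>>0. \<forall>y\<in>Zp v. \<forall>z\<in>Zp v.
        y \<noteq> z \<and> v (y - a) < \<delta> \<and> v (z - a) < \<delta> \<longrightarrow> v ((f y - f z) / (y - z) - l) < \<epsilon>)"

text \<open>Only the values of the integrand on \<open>Zp v\<close> matter.\<close>

definition has_volkenborn_integral ::
    "nat \<Rightarrow> ('c::field_char_0 \<Rightarrow> real) \<Rightarrow> ('c \<Rightarrow> 'c) \<Rightarrow> 'c \<Rightarrow> bool" where
  "has_volkenborn_integral p v f I \<longleftrightarrow>
     uniformly_differentiable v f \<and>
     limitin (vtopology v) (\<lambda>N. (\<Sum>y<p ^ N. f (of_nat y)) / of_nat (p ^ N)) I sequentially"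

end

theory Submission
  imports Defs
begin

text \<open>
  The Bernoulli identity is the residue change of variables \<open>u = exp t - 1\<close>, under which
  \<open>log (1 + u) (1 + u)\<^sup>x u\<^sup>-\<^sup>n\<^sup>-\<^sup>2 du\<close> becomes \<open>t exp ((x + 1) t) (exp t - 1)\<^sup>-\<^sup>n\<^sup>-\<^sup>2 dt\<close>. For the
  integral, the Riemann sums telescope: with \<open>M = p\<^sup>N\<close> and the Vandermonde identity they become
  \<open>((x + M gchoose n + 1) - (x gchoose n + 1)) / M
     = (\<Sum>k\<le>n. (M - 1 gchoose k) / (k + 1) * (x gchoose n - k))\<close>,
  a polynomial in \<open>M\<close>, and \<open>M\<close> tends to \<open>0\<close> in the \<open>p\<close>-adic absolute value.
\<close>

unbundle no vec_syntax


section \<open>Change of variables in a formal residue\<close>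

text \<open>As \<open>Q\<close> is \<open>fps_X / G\<close>, this coefficient is the residue of G' /
  G^(d+1). For d > 0 that quotient is the derivative of a Laurent series, so the residue vanishes;
  for d = 0 it is the order of the simple zero of \<open>G\<close>.\<close>

lemma fps_nth_deriv_mult_power:
  fixes G Q :: "'a::field_char_0 fps"
  assumes GQ: "G * Q = fps_X" and G0: "G $ 0 = 0"
  shows "(fps_deriv G * Q ^ Suc d) $ d = (if d = 0 then 1 else 0)"
proof -
  have "fps_deriv (G * Q) = 1"
    by (simp add: GQ)
  then have deriv: "fps_deriv G * Q = 1 - G * fps_deriv Q"
    by (simp add: algebra_simps)
  show ?thesis
  proof (cases d)
    case 0
    have "(fps_deriv G * Q) $ 0 = 1"
      unfolding deriv by (simp add: G0)
    with 0 show ?thesis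
      by simp
  next
    case (Suc e)
    have "fps_deriv G * Q ^ Suc d = Q ^ d - (G * Q) * (fps_deriv Q * Q ^ e)"
    proof -
      have "fps_deriv G * Q ^ Suc d = (fps_deriv G * Q) * Q ^ d"
        by (simp add: mult.assoc)
      also have "\<dots> = Q ^ d - (G * Q) * (fps_deriv Q * Q ^ e)"
        unfolding deriv by (simp add: Suc algebra_simps)
      finally show ?thesis .
    qed
    moreover have "fps_deriv (Q ^ d) = fps_const (of_nat d) * (fps_deriv Q * Q ^ e)"
      by (subst fps_deriv_power) (simp add: Suc mult.assoc)
    \<comment> \<open>Multiplying a derivative by \<open>fps_X\<close> scales the
      \<open>d\<close>-th coefficient by \<open>d\<close>, so the two terms on the right cancel
      there; characteristic 0 then allows cancelling \<open>d\<close>.\<close>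
    ultimately have "fps_const (of_nat d) * (fps_deriv G * Q ^ Suc d)
        = fps_const (of_nat d) * Q ^ d - fps_X * fps_deriv (Q ^ d)"
      by (simp only: GQ right_diff_distrib mult.left_commute)
    then have "(fps_const (of_nat d) * (fps_deriv G * Q ^ Suc d)) $ d = 0"
      using Suc by (simp only: fps_sub_nth fps_mult_left_const_nth fps_X_mult_nth fps_deriv_nth) simp
    then have "of_nat d * (fps_deriv G * Q ^ Suc d) $ d = 0"
      by (simp only: fps_mult_left_const_nth)
    then show ?thesis
      using Suc by (metis mult_eq_0_iff of_nat_eq_0_iff nat.distinct(1))
  qed
qed

text \<open>
  With \<open>Q\<close> in the role of \<open>fps_X / G\<close>, this says that \<open>H(u) u\<^sup>-\<^sup>m\<^sup>-\<^sup>1 du\<close> and its pullback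
  along \<open>u = G(t)\<close> have the same residue.
\<close>
lemma fps_nth_compose_mult_deriv:
  fixes G Q H :: "'a::field_char_0 fps"
  assumes GQ: "G * Q = fps_X" and G0: "G $ 0 = 0"
  shows "((H oo G) * (fps_deriv G * Q ^ Suc m)) $ m = H $ m"
proof -
  define K where "K = fps_deriv G * Q ^ Suc m"
  \<comment> \<open>A common cutoff \<open>m\<close> works for every \<open>j\<close>, because
    \<open>G ^ i\<close> has no coefficient below degree \<open>i\<close>.\<close>
  have comp: "(H oo G) $ j = (\<Sum>i=0..m. H $ i * (G ^ i) $ j)" if "j \<le> m" for j
    unfolding fps_compose_nth using that
    by (intro sum.mono_neutral_left) (auto simp: startsby_zero_power_prefix[OF G0])
  have "((H oo G) * K) $ m = (\<Sum>j=0..m. (\<Sum>i=0..m. H $ i * (G ^ i) $ j) * K $ (m - j))"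
    by (simp add: fps_mult_nth comp)
  also have "\<dots> = (\<Sum>i=0..m. H $ i * (G ^ i * K) $ m)"
    unfolding fps_mult_nth sum_distrib_left sum_distrib_right
    by (subst sum.swap) (simp add: mult.assoc)
  also have "\<dots> = (\<Sum>i=0..m. H $ i * (if i = m then 1 else 0))"
  proof (intro sum.cong refl)
    fix i assume "i \<in> {0..m}"
    then have i: "i \<le> m" and "Suc m = i + Suc (m - i)"
      by auto
    \<comment> \<open>Pairing \<open>i\<close> of the factors \<open>Q\<close> with
      \<open>G ^ i\<close> gives \<open>fps_X ^ i\<close>, a mere index shift, and leaves the
      previous lemma at \<open>d = m - i\<close>.\<close>
    then have "G ^ i * K = (G * Q) ^ i * (fps_deriv G * Q ^ Suc (m - i))"
      unfolding K_def by (metis (no_types, lifting) mult.assoc mult.left_commute power_add power_mult_distrib)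
    then have "(G ^ i * K) $ m = (fps_deriv G * Q ^ Suc (m - i)) $ (m - i)"
      using i by (simp only: GQ fps_X_power_mult_nth) simp
    then show "H $ i * (G ^ i * K) $ m = H $ i * (if i = m then 1 else 0)"
      using i by (simp only: fps_nth_deriv_mult_power[OF GQ G0]) simp
  qed
  also have "\<dots> = H $ m"
    by (simp add: mult_delta_right)
  finally show ?thesis
    by (simp add: K_def)
qed

section \<open>Substituting exp t - 1 into the two generating series\<close>

lemma fps_ln_1_compose_exp: "fps_ln 1 oo (fps_exp 1 - 1) = (fps_X :: 'a::field_char_0 fps)"
  by (subst fps_ln_fps_exp_inv) (simp_all add: fps_inv)

text \<open>Both sides solve F' = x F with constant term 1. For the left side this follows from (1 +
  t) B' = x B, since the substitution turns 1 + t into exp t, the inner derivative.\<close>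

lemma fps_binomial_compose_exp:
  "fps_binomial x oo (fps_exp 1 - 1) = fps_exp (x :: 'a::field_char_0)"
proof -
  let ?G = "fps_exp 1 - 1 :: 'a fps" and ?B = "fps_binomial x"
  have "(1 + fps_X) * fps_deriv ?B = fps_const x * ?B"
    unfolding fps_binomial_deriv
    by (subst dvd_mult_div_cancel) (simp_all add: fps_dvd_iff)
  then have "((1 + fps_X) * fps_deriv ?B) oo ?G = (fps_const x * ?B) oo ?G"
    by simp
  then have "fps_exp 1 * (fps_deriv ?B oo ?G) = fps_const x * (?B oo ?G)"
    by (simp add: fps_compose_mult_distrib fps_compose_add_distrib)
  then have "fps_deriv (?B oo ?G) = fps_const x * (?B oo ?G)"
    by (simp add: fps_compose_deriv mult.commute)
  then show ?thesis
    by (simp add: fps_exp_unique_ODE)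
qed

text \<open>Comparing values at scalars suffices, because a field of characteristic 0 is
  infinite.\<close>

lemma daehee_poly_eq_bernoulli_poly:
  "(daehee_poly n :: 'a::field_char_0 poly) = pcompose (bernoulli_poly (int n + 2) n) [:1, 1:]"
proof (rule poly_ext)
  fix x :: 'a
  define G where "G = (fps_exp 1 - 1 :: 'a fps)"
  define Q where "Q = fps_X / G"
  have G0: "G $ 0 = 0" and G1: "G $ 1 = 1"
    by (simp_all add: G_def)
  have "G \<noteq> 0" "subdegree G = 1"
    using G0 G1 by (auto intro: subdegreeI)
  then have "G dvd fps_X"
    by (simp add: fps_dvd_iff)
  then have GQ: "G * Q = fps_X"
    by (simp add: Q_def)
  have "(fps_ln 1 / fps_X * fps_binomial x) $ n = (fps_ln 1 * fps_binomial x) $ Suc n"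
  proof -
    have "fps_X dvd (fps_ln 1 :: 'a fps)"
      by (simp add: fps_dvd_iff subdegree_geI)
    then have "fps_ln 1 * fps_binomial x = fps_X * (fps_ln 1 / fps_X * fps_binomial x)"
      by (simp del: fps_divide_X flip: mult.assoc)
    then show ?thesis
      by (simp only: fps_X_mult_nth nat.simps if_False diff_Suc_1)
  qed
  \<comment> \<open>The division by t has raised the index to n + 1, hence \<open>m = Suc n\<close>
    and the order n + 2.\<close>
  also have "\<dots> = ((fps_ln 1 * fps_binomial x oo G) * (fps_deriv G * Q ^ Suc (Suc n))) $ Suc n"
    by (rule fps_nth_compose_mult_deriv[OF GQ G0, symmetric])
  also have "fps_ln 1 * fps_binomial x oo G = fps_X * fps_exp x"
    unfolding G_def by (simp add: fps_compose_mult_distrib fps_ln_1_compose_exp fps_binomial_compose_exp)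
  \<comment> \<open>The derivative of \<open>G\<close> is exp t, which accounts for the shift from x
    to x + 1.\<close>
  also have "fps_X * fps_exp x * (fps_deriv G * Q ^ Suc (Suc n))
      = fps_X * (Q ^ (n + 2) * fps_exp (x + 1))"
    by (simp add: G_def fps_exp_add_mult algebra_simps)
  also have "\<dots> $ Suc n = (Q powi (int n + 2) * fps_exp (x + 1)) $ n"
    by (simp add: power_int_def nat_add_distrib)
  finally show "poly (daehee_poly n) x
      = poly (pcompose (bernoulli_poly (int n + 2) n) [:1, 1:]) x"
    by (simp add: poly_daehee_poly poly_pcompose poly_bernoulli_poly Q_def G_def add.commute)
qed


section \<open>Polynomials over an ultrametric field\<close>

context ultrametric_absolute_value
begin

lemma v_zero: "v 0 = 0"
  by (simp add: eq_0_iff)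

section \<open>Boundedness, Lipschitz and differentiability estimates on the unit ball\<close>

lemma poly_bounded:
  obtains B where "B \<ge> 0" "\<And>z. v z \<le> 1 \<Longrightarrow> v (poly q z) \<le> B"
proof (induction q arbitrary: thesis)
  case 0
  show ?case
    by (rule 0[of 0]) (simp_all add: v_zero)
next
  case (pCons c q)
  obtain B where B: "B \<ge> 0" "\<And>z. v z \<le> 1 \<Longrightarrow> v (poly q z) \<le> B"
    using pCons.IH by blast
  show ?case
  proof (rule pCons.prems[of "max (v c) B"])
    show "max (v c) B \<ge> 0"
      using B by simp
    fix z assume z: "v z \<le> 1"
    have "v (z * poly q z) \<le> 1 * B"
      unfolding mult by (intro mult_mono z B nonneg) simp
    then show "v (poly (pCons c q) z) \<le> max (v c) B"
      using ultrametric[of c "z * poly q z"] by simp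
  qed
qed

lemma poly_lipschitz:
  obtains L where "L \<ge> 0"
    "\<And>y z. v y \<le> 1 \<Longrightarrow> v z \<le> 1 \<Longrightarrow> v (poly q y - poly q z) \<le> L * v (y - z)"
proof (induction q arbitrary: thesis)
  case 0
  show ?case
    by (rule 0[of 0]) (simp_all add: v_zero)
next
  case (pCons c q)
  obtain B where B: "B \<ge> 0" "\<And>z. v z \<le> 1 \<Longrightarrow> v (poly q z) \<le> B"
    using poly_bounded by blast
  obtain L where L: "L \<ge> 0"
      "\<And>y z. v y \<le> 1 \<Longrightarrow> v z \<le> 1 \<Longrightarrow> v (poly q y - poly q z) \<le> L * v (y - z)"
    using pCons.IH by blast
  show ?case
  proof (rule pCons.prems[of "max L B"])
    show "max L B \<ge> 0"
      using B by simp
    fix y z assume yz: "v y \<le> 1" "v z \<le> 1"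
    have eq: "poly (pCons c q) y - poly (pCons c q) z
        = y * (poly q y - poly q z) + (y - z) * poly q z"
      by (simp add: algebra_simps)
    have "v (y * (poly q y - poly q z)) \<le> 1 * (L * v (y - z))"
      unfolding mult by (intro mult_mono yz L nonneg) simp
    also have "\<dots> \<le> max L B * v (y - z)"
      by (simp add: mult_right_mono nonneg)
    finally have 1: "v (y * (poly q y - poly q z)) \<le> max L B * v (y - z)" .
    have "v ((y - z) * poly q z) \<le> v (y - z) * max L B"
      unfolding mult using B(2)[OF yz(2)] by (intro mult_left_mono nonneg) simp
    with 1 show "v (poly (pCons c q) y - poly (pCons c q) z) \<le> max L B * v (y - z)"
      unfolding eq by (intro order_trans[OF ultrametric]) (simp add: mult.commute)
  qed
qed

text \<open>Letting both \<open>y\<close> and \<open>z\<close> vary near \<open>a\<close> matches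
  the two-point difference quotient in \<open>uniformly_differentiable\<close>.\<close>

lemma poly_strictly_differentiable:
  assumes a: "v a \<le> 1"
  obtains C where "C \<ge> 0"
    "\<And>y z. v y \<le> 1 \<Longrightarrow> v z \<le> 1 \<Longrightarrow>
       v (poly q y - poly q z - (y - z) * poly (pderiv q) a)
         \<le> C * v (y - z) * max (v (y - a)) (v (z - a))"
proof (induction q arbitrary: thesis)
  case 0
  show ?case
    by (rule 0[of 0]) (simp_all add: v_zero)
next
  case (pCons c q)
  define d where "d = poly (pderiv q) a"
  obtain L where L: "L \<ge> 0"
      "\<And>y z. v y \<le> 1 \<Longrightarrow> v z \<le> 1 \<Longrightarrow> v (poly q y - poly q z) \<le> L * v (y - z)"
    using poly_lipschitz by blast
  obtain C where C: "C \<ge> 0"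
      "\<And>y z. v y \<le> 1 \<Longrightarrow> v z \<le> 1 \<Longrightarrow> v (poly q y - poly q z - (y - z) * d)
         \<le> C * v (y - z) * max (v (y - a)) (v (z - a))"
    using pCons.IH unfolding d_def by blast
  \<comment> \<open>One constant for three error terms: \<open>C\<close> for the inductive
    remainder, \<open>L\<close> for the variation of \<open>q\<close>, \<open>v d\<close> for the
    linear term. By the ultrametric inequality a maximum is enough.\<close>
  define K where "K = max C (max L (v d))"
  have K: "K \<ge> 0" "C \<le> K" "L \<le> K" "v d \<le> K"
    using C by (auto simp: K_def)
  show ?case
  proof (rule pCons.prems[of K])
    show "K \<ge> 0" by fact
    fix y z assume yz: "v y \<le> 1" "v z \<le> 1"
    define m where "m = max (v (y - a)) (v (z - a))"
    have m: "m \<ge> 0" "v (y - a) \<le> m" "v (z - a) \<le> m"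
      using nonneg[of "y - a"] by (auto simp: m_def le_max_iff_disj)
    let ?r = "poly q y - poly q z - (y - z) * d"
    have eq: "poly (pCons c q) y - poly (pCons c q) z - (y - z) * poly (pderiv (pCons c q)) a
        = y * ?r + ((y - z) * (poly q z - poly q a) + (y - z) * ((y - a) * d))"
      by (simp add: pderiv_pCons d_def algebra_simps)
    have r: "v ?r \<le> C * v (y - z) * m"
      using C(2)[OF yz] by (simp add: m_def)
    have "v (y * ?r) \<le> 1 * (C * v (y - z) * m)"
      unfolding mult by (intro mult_mono yz r nonneg) simp
    also have "\<dots> \<le> K * v (y - z) * m"
      using K m nonneg[of "y - z"] by (simp add: mult_right_mono)
    finally have 1: "v (y * ?r) \<le> K * v (y - z) * m" .
    have "v (poly q z - poly q a) \<le> L * v (z - a)"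
      by (rule L) (use yz a in auto)
    also have "\<dots> \<le> K * m"
      using K m L nonneg by (intro mult_mono) auto
    finally have "v (poly q z - poly q a) \<le> K * m" .
    then have 2: "v ((y - z) * (poly q z - poly q a)) \<le> K * v (y - z) * m"
      using nonneg[of "y - z"] mult_left_mono[of "v (poly q z - poly q a)" "K * m" "v (y - z)"]
      by (simp add: mult ac_simps)
    have "v (y - a) * v d \<le> m * K"
      using K m nonneg by (intro mult_mono) auto
    then have 3: "v ((y - z) * ((y - a) * d)) \<le> K * v (y - z) * m"
      using nonneg[of "y - z"] mult_left_mono[of "v (y - a) * v d" "m * K" "v (y - z)"]
      by (simp add: mult ac_simps)
    show "v (poly (pCons c q) y - poly (pCons c q) z - (y - z) * poly (pderiv (pCons c q)) a)
        \<le> K * v (y - z) * max (v (y - a)) (v (z - a))"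
      unfolding eq m_def[symmetric]
      by (intro order_trans[OF ultrametric] max.boundedI 1 2 3)
  qed
qed

lemma uniformly_differentiable_poly: "uniformly_differentiable v (poly q)"
  unfolding uniformly_differentiable_def
proof (intro ballI)
  fix a assume "a \<in> Zp v"
  then have "v a \<le> 1"
    by (simp add: Zp_def)
  then obtain C where C: "C \<ge> 0"
      "\<And>y z. v y \<le> 1 \<Longrightarrow> v z \<le> 1 \<Longrightarrow>
         v (poly q y - poly q z - (y - z) * poly (pderiv q) a)
           \<le> C * v (y - z) * max (v (y - a)) (v (z - a))"
    using poly_strictly_differentiable by blast
  show "\<exists>l. \<forall>\<epsilon>>0. \<exists>\<delta>>0. \<forall>y\<in>Zp v. \<forall>z\<in>Zp v.
      y \<noteq> z \<and> v (y - a) < \<delta> \<and> v (z - a) < \<delta> \<longrightarrow> v ((poly q y - poly q z) / (y - z) - l) < \<epsilon>"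
  proof (rule exI[of _ "poly (pderiv q) a"], intro allI impI)
    fix \<epsilon> :: real assume \<epsilon>: "\<epsilon> > 0"
    show "\<exists>\<delta>>0. \<forall>y\<in>Zp v. \<forall>z\<in>Zp v. y \<noteq> z \<and> v (y - a) < \<delta> \<and> v (z - a) < \<delta> \<longrightarrow>
        v ((poly q y - poly q z) / (y - z) - poly (pderiv q) a) < \<epsilon>"
    \<comment> \<open>Adding 1 covers \<open>C = 0\<close> and makes the final bound strict.\<close>
    proof (rule exI[of _ "\<epsilon> / (C + 1)"], intro conjI ballI impI)
      show "\<epsilon> / (C + 1) > 0"
        using \<epsilon> C by simp
      fix y z
      assume yz: "y \<in> Zp v" "z \<in> Zp v"
        and "y \<noteq> z \<and> v (y - a) < \<epsilon> / (C + 1) \<and> v (z - a) < \<epsilon> / (C + 1)"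
      then have ne: "y \<noteq> z" and close: "max (v (y - a)) (v (z - a)) < \<epsilon> / (C + 1)"
        by auto
      define r where "r = (poly q y - poly q z) / (y - z) - poly (pderiv q) a"
      have pos: "v (y - z) > 0"
        using ne nonneg[of "y - z"] eq_0_iff[of "y - z"] by simp
      have "(y - z) * r = poly q y - poly q z - (y - z) * poly (pderiv q) a"
        using ne by (simp add: r_def field_simps)
      then have "v (y - z) * v r \<le> C * v (y - z) * max (v (y - a)) (v (z - a))"
        using C(2)[of y z] yz by (simp add: Zp_def flip: mult)
      then have "v r \<le> C * max (v (y - a)) (v (z - a))"
        using pos by (simp add: mult.left_commute mult.assoc)
      also have "\<dots> \<le> C * (\<epsilon> / (C + 1))"
        using close C by (intro mult_left_mono) auto
      also have "\<dots> < \<epsilon>"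
        using \<epsilon> C by (simp add: field_simps)
      finally show "v ((poly q y - poly q z) / (y - z) - poly (pderiv q) a) < \<epsilon>"
        by (simp add: r_def)
    qed
  qed
qed

section \<open>Limits along powers of a small element\<close>

lemma v_power: "v (a ^ n) = v a ^ n"
  by (induction n) (simp_all add: v_one mult)

lemma limitin_poly_powers:
  assumes "v a < 1"
  shows "limitin (vtopology v) (\<lambda>N. poly q (a ^ N)) (poly q 0) sequentially"
proof -
  obtain L where L: "L \<ge> 0"
      "\<And>y z. v y \<le> 1 \<Longrightarrow> v z \<le> 1 \<Longrightarrow> v (poly q y - poly q z) \<le> L * v (y - z)"
    using poly_lipschitz by blast
  have "(\<lambda>N. L * v a ^ N) \<longlonglongrightarrow> L * 0"
    using assms nonneg by (intro tendsto_mult_left LIMSEQ_power_zero) simp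
  moreover have "v (poly q (a ^ N) - poly q 0) \<le> L * v a ^ N" for N
  proof -
    have "v (a ^ N) \<le> 1" "v 0 \<le> 1"
      using assms nonneg by (auto simp: v_power power_le_one v_zero)
    from L(2)[OF this] show ?thesis
      by (simp add: v_power)
  qed
  ultimately have "(\<lambda>N. v (poly q (a ^ N) - poly q 0)) \<longlonglongrightarrow> 0"
    by - (rule Lim_null_comparison[where g = "\<lambda>N. L * v a ^ N"], simp_all add: nonneg)
  then show ?thesis
    by (simp add: limitin_metric_dist_null)
qed

end


section \<open>Riemann sums of falling factorials\<close>

text \<open>By Pascal's rule each summand is a forward difference, so the sum telescopes.\<close>

lemma sum_gbinomial_shift:
  fixes x :: "'a::field_char_0"
  shows "(\<Sum>y<M. (x + of_nat y) gchoose n) = ((x + of_nat M) gchoose Suc n) - (x gchoose Suc n)"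
proof (induction M)
  case (Suc M)
  then show ?case
    using gbinomial_Suc_Suc[of "x + of_nat M" n] by (simp add: algebra_simps)
qed simp

text \<open>Absorption, \<open>M gchoose (k + 1) = M / (k + 1) * ((M - 1) gchoose k)\<close>,
  cancels the denominator \<open>M\<close>, so the right side still makes sense at M = 0.\<close>

lemma sum_gbinomial_shift_divide:
  fixes x :: "'a::field_char_0"
  assumes "M > 0"
  shows "(\<Sum>y<M. (x + of_nat y) gchoose n) / of_nat M
    = (\<Sum>k=0..n. ((of_nat M - 1) gchoose k) / of_nat (Suc k) * (x gchoose (n - k)))"
proof -
  have "(x + of_nat M) gchoose Suc n
      = (\<Sum>k=0..Suc n. (of_nat M gchoose k) * (x gchoose (Suc n - k)))"
    by (simp only: gbinomial_Vandermonde add.commute)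
  also have "\<dots> = (x gchoose Suc n)
      + (\<Sum>k=0..n. (of_nat M gchoose Suc k) * (x gchoose (n - k)))"
    by (subst sum.atLeast0_atMost_Suc_shift) simp
  finally have "(\<Sum>y<M. (x + of_nat y) gchoose n)
      = (\<Sum>k=0..n. (of_nat M gchoose Suc k) * (x gchoose (n - k)))"
    by (simp add: sum_gbinomial_shift)
  also have "\<dots> / of_nat M
      = (\<Sum>k=0..n. ((of_nat M - 1) gchoose k) / of_nat (Suc k) * (x gchoose (n - k)))"
    unfolding sum_divide_distrib using assms
    by (intro sum.cong refl) (simp add: gbinomial_absorption' del: of_nat_Suc)
  finally show ?thesis .
qed

text \<open>The indeterminate stands for the number M of summands, with \<open>x\<close> a
  parameter; composing with \<open>[:- 1, 1:]\<close> produces M - 1.\<close>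

definition riemann_sum_poly :: "'a::field_char_0 \<Rightarrow> nat \<Rightarrow> 'a poly" where
  "riemann_sum_poly x n =
     (\<Sum>k=0..n. smult (fact n * (x gchoose (n - k)) / (fact k * of_nat (Suc k)))
                  (pcompose (falling [:0, 1:] k) [:- 1, 1:]))"

lemma poly_riemann_sum_poly:
  "poly (riemann_sum_poly x n) z
    = fact n * (\<Sum>k=0..n. ((z - 1) gchoose k) / of_nat (Suc k) * (x gchoose (n - k)))"
proof -
  have "poly (pcompose (falling [:0, 1:] k) [:- 1, 1:]) z = fact k * ((z - 1) gchoose k)" for k
    by (simp add: poly_pcompose poly_falling falling_eq_gbinomial)
  then show ?thesis
    unfolding riemann_sum_poly_def poly_sum sum_distrib_left
    by (intro sum.cong refl) (simp add: field_simps del: of_nat_Suc)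
qed

text \<open>At M = 0 the weights become (-1)^k / (k + 1), the coefficients of log(1 + t) / t, and
  the sum is their Cauchy product with those of (1 + t)^x.\<close>

lemma poly_riemann_sum_poly_0: "poly (riemann_sum_poly x n) 0 = poly (daehee_poly n) x"
proof -
  have "((- 1 :: 'a) gchoose k) = (- 1) ^ k" for k
    using gbinomial_minus[of "1 :: 'a" k] by (simp flip: binomial_gbinomial)
  then show ?thesis
    by (simp add: poly_riemann_sum_poly poly_daehee_poly fps_mult_nth fps_ln_nth)
qed

lemma poly_riemann_sum_poly_of_nat:
  assumes "M > 0"
  shows "poly (riemann_sum_poly x n) (of_nat M) = (\<Sum>y<M. falling (x + of_nat y) n) / of_nat M"
  using sum_gbinomial_shift_divide[OF assms, of x n, symmetric]
  by (simp only: poly_riemann_sum_poly falling_eq_gbinomial times_divide_eq_right flip: sum_distrib_left)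

lemma (in complex_padic_field) has_volkenborn_integral_falling:
  assumes "prime p"
  shows "has_volkenborn_integral p v (\<lambda>y. falling (x + y) n) (poly (daehee_poly n) x)"
  unfolding has_volkenborn_integral_def
proof
  have "(\<lambda>y. falling (x + y) n) = poly (pcompose (falling [:0, 1:] n) [:x, 1:])"
    by (simp add: fun_eq_iff poly_pcompose poly_falling)
  then show "uniformly_differentiable v (\<lambda>y. falling (x + y) n)"
    by (simp add: uniformly_differentiable_poly)
  \<comment> \<open>Hence p^N tends to 0, and the Riemann sums, being the values of one polynomial
    at p^N, tend to its value at 0.\<close>
  have "v (of_nat p) < 1"
    using prime_gt_1_nat[OF assms] by (simp add: v_p)
  from limitin_poly_powers[OF this, of "riemann_sum_poly x n"]
  show "limitin (vtopology v) (\<lambda>N. (\<Sum>y<p ^ N. falling (x + of_nat y) n) / of_nat (p ^ N))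
      (poly (daehee_poly n) x) sequentially"
    using prime_gt_0_nat[OF assms]
    by (simp add: poly_riemann_sum_poly_0 flip: of_nat_power poly_riemann_sum_poly_of_nat)
qed

theorem theorem2:
  fixes p n :: nat and v :: "'c::field_char_0 \<Rightarrow> real"
  assumes "prime p"
  shows "(complex_padic_field p v \<longrightarrow>
            (\<forall>x\<in>Zp v. has_volkenborn_integral p v (\<lambda>y. falling (x + y) n)
                         (poly (daehee_poly n) x))) \<and>
         (daehee_poly n :: 'c poly) = pcompose (bernoulli_poly (int n + 2) n) [:1, 1:]"
  using complex_padic_field.has_volkenborn_integral_falling[OF _ assms]
    daehee_poly_eq_bernoulli_poly by blast

end
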